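(* Let $W$ be a symmetric communication matrix ($W^{\top}=W$) of a strongly connected network of $n\ge2$ agents, and suppose $W$ is positive semi-definite. For $i,j\in[n]$ let $$\bar W(i,j)=W+[W]_{ij}\,(e_i-e_j)(e_i-e_j)^{\top},$$ where $e_i$ is the $i$-th standard basis vector of $\mathbb{R}^n$. Then for any $i,j\in[n]$, $$\lambda_{\max}(W)\le\lambda_{\max}\big(\bar W(i,j)\big).$$
   Context: $W$ is an $n\times n$ nonnegative row-stochastic matrix with entries $[W]_{ij}$ whose associated graph (edge $(i,j)$, $i\ne j$, iff $[W]_{ij}>0$) is strongly connected. $\lambda_k(M)$ denotes the $k$-th largest eigenvalue of a symmetric $n\times n$ matrix $M$, and $\lambda_{\max}(M)=\max\{|\lambda_n(M)|,|\lambda_2(M)|\}$ (not the largest eigenvalue). $[n]=\{1,\dots,n\}$. The matrix $\bar W(i,j)$ corresponds to removing the edges $(i,j)$ and $(j,i)$ and adding their weight to the self-weights of $i$ and $j$. *)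

theory Defs
  imports
    "Jordan_Normal_Form.Char_Poly"
    "Graph_Theory.Digraph_Component"
begin

text \<open>
  Matrices are those of \<^theory>\<open>Jordan_Normal_Form.Matrix\<close>, whose indices start at 0: the agents
  \<open>1, \<dots>, n\<close> are represented by \<open>0, \<dots>, n - 1\<close>.
\<close>

definition row_stochastic :: "nat \<Rightarrow> real mat \<Rightarrow> bool" where
  "row_stochastic n W \<longleftrightarrow>
     W \<in> carrier_mat n n \<and>
     (\<forall>i<n. \<forall>j<n. 0 \<le> W $$ (i, j)) \<and>
     (\<forall>i<n. (\<Sum>j<n. W $$ (i, j)) = 1)"

definition communication_graph :: "real mat \<Rightarrow> (nat, nat \<times> nat) pre_digraph" where
  "communication_graph W =
     \<lparr> verts = {..<dim_row W},
       arcs = {(i, j). i < dim_row W \<and> j < dim_row W \<and> i \<noteq> j \<and> W $$ (i, j) > 0},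
       tail = fst,
       head = snd \<rparr>"

definition positive_semidefinite :: "real mat \<Rightarrow> bool" where
  "positive_semidefinite A \<longleftrightarrow>
     square_mat A \<and> transpose_mat A = A \<and>
     (\<forall>v \<in> carrier_vec (dim_row A). 0 \<le> v \<bullet> (A *\<^sub>v v))"

text \<open>
  The real eigenvalues in decreasing order, each repeated according to its multiplicity as a root
  of the characteristic polynomial. For a symmetric \<open>n \<times> n\<close> matrix this list has length \<open>n\<close>.
\<close>
definition eigenvalues_desc :: "real mat \<Rightarrow> real list" where
  "eigenvalues_desc M = rev (sorted_list_of_multiset (proots (char_poly M)))"

text \<open>
  The \<open>k\<close>-th largest eigenvalue, where \<open>k\<close> is counted from 1. It is meaningful only for a
  symmetric \<open>n \<times> n\<close> matrix and \<open>1 \<le> k \<le> n\<close>.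
\<close>
definition kth_eigenvalue :: "nat \<Rightarrow> real mat \<Rightarrow> real" where
  "kth_eigenvalue k M = eigenvalues_desc M ! (k - 1)"

text \<open>Despite its name, \<open>lambda_max\<close> is not the largest eigenvalue: it leaves out the first one.\<close>
definition lambda_max :: "real mat \<Rightarrow> real" where
  "lambda_max M = max \<bar>kth_eigenvalue (dim_row M) M\<bar> \<bar>kth_eigenvalue 2 M\<bar>"

definition outer_product :: "real vec \<Rightarrow> real vec \<Rightarrow> real mat" where
  "outer_product u v = mat_of_cols (dim_vec u) [u] * mat_of_rows (dim_vec v) [v]"

definition remove_edge :: "real mat \<Rightarrow> nat \<Rightarrow> nat \<Rightarrow> real mat" where
  "remove_edge W i j =
     (let d = unit_vec (dim_row W) i - unit_vec (dim_row W) j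
      in W + W $$ (i, j) \<cdot>\<^sub>m outer_product d d)"

end

theory Submission
  imports Defs "Jordan_Normal_Form.Schur_Decomposition"
begin

text \<open>
  For positive semi-definite \<open>W\<close> all eigenvalues are nonnegative, so \<open>lambda_max W\<close> is just the
  second largest one. Removing an edge adds the nonnegative multiple \<open>[W]\<^sub>i\<^sub>j\<close> of
  \<open>d d\<^sup>T\<close>, \<open>d = e\<^sub>i - e\<^sub>j\<close>, so it increases the quadratic form and hence, by the Courant-Fischer
  principle, the second eigenvalue.
\<close>

section \<open>Spectrum of a real symmetric matrix\<close>

lemma conjugate_real_vec [simp]: "conjugate (v :: real vec) = v"
  by (intro eq_vecI) auto

lemma real_scalar_prod_self_pos:
  fixes v :: "real vec"
  assumes "v \<in> carrier_vec n" "v \<noteq> 0\<^sub>v n"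
  shows "0 < v \<bullet> v"
proof -
  have "v \<bullet> v \<noteq> 0"
    using conjugate_square_eq_0_vec[OF assms(1)] assms(2) by simp
  moreover have "0 \<le> v \<bullet> v"
    by (auto simp: scalar_prod_def intro: sum_nonneg)
  ultimately show ?thesis by simp
qed

text \<open>Evaluate the Hermitian form of \<open>?C\<close> at an eigenvector in two ways: symmetry
  moves \<open>?C\<close> to the second factor, and its real entries let it commute with
  conjugation. This gives \<open>a * (v \<bullet>c v) = cnj a * (v \<bullet>c v)\<close> with
  \<open>v\<close> nonzero.\<close>

lemma symmetric_eigenvalue_real:
  fixes A :: "real mat"
  assumes A: "A \<in> carrier_mat n n" and sym: "transpose_mat A = A"
    and ev: "eigenvalue (map_mat complex_of_real A) a"
  shows "a \<in> \<real>"
proof -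
  let ?C = "map_mat complex_of_real A"
  have C: "?C \<in> carrier_mat n n" using A by simp
  have symC: "transpose_mat ?C = ?C"
    using sym by (metis map_mat_transpose)
  obtain v where "eigenvector ?C v a" using ev unfolding eigenvalue_def by blast
  then have v: "v \<in> carrier_vec n" and v0: "v \<noteq> 0\<^sub>v n" and Cv: "?C *\<^sub>v v = a \<cdot>\<^sub>v v"
    using C unfolding eigenvector_def by auto
  have v': "conjugate v \<in> carrier_vec n" using v by simp
  have conj: "?C *\<^sub>v conjugate v = conjugate (?C *\<^sub>v v)"
    using A v by (intro eq_vecI) (auto simp: scalar_prod_def)
  have "a * (v \<bullet>c v) = (?C *\<^sub>v v) \<bullet>c v"
    using v v' by (simp add: Cv)
  also have "\<dots> = v \<bullet> (?C *\<^sub>v conjugate v)"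
    using transpose_vec_mult_scalar[OF C v' v] by (simp add: symC)
  also have "\<dots> = cnj a * (v \<bullet>c v)"
    using v v' by (simp add: conj Cv conjugate_smult_vec)
  finally have "a = cnj a"
    using conjugate_square_eq_0_vec[OF v] v0 by simp
  then show ?thesis by (simp add: complex_is_Real_iff complex_eq_iff)
qed

text \<open>Over the complex numbers the characteristic polynomial splits into \<open>n\<close>
  linear factors; all its roots are real, so the splitting descends to the reals. Hence
  \<open>proots\<close>, which sees only real roots, misses none, and
  \<open>eigenvalues_desc\<close> has full length.\<close>

lemma symmetric_char_poly_proots:
  fixes A :: "real mat"
  assumes A: "A \<in> carrier_mat n n" and sym: "transpose_mat A = A"
  shows "char_poly A = (\<Prod>e\<in>#proots (char_poly A). [:-e, 1:])"
    and "size (proots (char_poly A)) = n"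
proof -
  let ?C = "map_mat complex_of_real A"
  have C: "?C \<in> carrier_mat n n" using A by simp
  interpret h: map_poly_inj_idom_hom complex_of_real ..
  obtain as where as: "char_poly ?C = (\<Prod>a\<leftarrow>as. [:-a, 1:])" and len: "length as = n"
    using char_poly_factorized[OF C] by blast
  have real: "a \<in> \<real>" if "a \<in> set as" for a
  proof -
    have "poly (char_poly ?C) a = 0"
      using that unfolding as poly_prod_list by (auto simp: prod_list_zero_iff image_iff)
    then show ?thesis
      using symmetric_eigenvalue_real[OF A sym] eigenvalue_root_char_poly[OF C] by blast
  qed
  \<comment> \<open>Since every root is real, taking real parts loses nothing. Injectivity of the
    embedding on polynomials then yields the factorization over the reals.\<close>
  define rs where "rs = map Re as"
  have as_rs: "as = map complex_of_real rs"
    unfolding rs_def using real by (induction as) auto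
  have "map_poly complex_of_real (char_poly A) = map_poly complex_of_real (\<Prod>e\<leftarrow>rs. [:-e, 1:])"
    unfolding of_real_hom.char_poly_hom[OF A, symmetric] as as_rs
    by (simp add: h.hom_prod_list o_def)
  then have cp: "char_poly A = (\<Prod>e\<leftarrow>rs. [:-e, 1:])"
    by simp
  have "proots (\<Prod>p\<leftarrow>map (\<lambda>e. [:-e, 1:]) rs. p) = (\<Sum>p\<leftarrow>map (\<lambda>e. [:-e, 1:]) rs. proots p)"
    by (rule proots_prod_list) auto
  also have "\<dots> = mset rs"
    by (induction rs) auto
  finally have pr: "proots (char_poly A) = mset rs"
    unfolding cp by simp
  show "char_poly A = (\<Prod>e\<in>#proots (char_poly A). [:-e, 1:])"
    unfolding pr unfolding cp by (simp flip: prod_mset_prod_list)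
  show "size (proots (char_poly A)) = n"
    unfolding pr using len by (simp add: rs_def)
qed

section \<open>Orthogonal diagonalization\<close>

text \<open>Complete \<open>v\<close> to a basis, apply Gram-Schmidt, which keeps the first vector,
  and normalize the columns. The scalar \<open>c\<close> is the normalization of
  \<open>v\<close>.\<close>

lemma orthonormal_completion:
  fixes v :: "real vec"
  assumes v: "v \<in> carrier_vec n" and v0: "v \<noteq> 0\<^sub>v n"
  obtains P c where "P \<in> carrier_mat n n" "transpose_mat P * P = 1\<^sub>m n" "col P 0 = c \<cdot>\<^sub>v v"
proof -
  interpret cof_vec_space n "TYPE(real)" .
  define ws where "ws = gram_schmidt n (basis_completion v)"
  note b = basis_completion[OF v v0]
  have n: "n \<noteq> 0" using v v0 by auto
  have ws: "set ws \<subseteq> carrier_vec n" "corthogonal ws" "length ws = n"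
    using gram_schmidt_result[OF b(2,4,5) ws_def] b(6) by auto
  obtain vs where "basis_completion v = v # vs"
    using b(6,7) n by (cases "basis_completion v") auto
  then have hd: "ws ! 0 = v"
    using gram_schmidt_hd[OF v] ws(3) n by (metis ws_def hd_conv_nth length_0_conv)
  have wsc: "ws ! i \<in> carrier_vec n" if "i < n" for i
    using ws(1,3) that by auto
  \<comment> \<open>The equivalence also records that each vector has nonzero product with itself,
    which makes the normalization below legitimate.\<close>
  have orth: "ws ! i \<bullet> ws ! j = 0 \<longleftrightarrow> i \<noteq> j" if "i < n" "j < n" for i j
    using corthogonalD[OF ws(2), of i j] that ws(3) by simp
  define c where "c i = 1 / sqrt (ws ! i \<bullet> ws ! i)" for i
  define us where "us = map (\<lambda>i. c i \<cdot>\<^sub>v ws ! i) [0..<n]"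
  define P where "P = mat_of_cols n us"
  have P: "P \<in> carrier_mat n n" unfolding P_def us_def by (auto simp: mat_of_cols_def)
  have colP: "col P i = c i \<cdot>\<^sub>v ws ! i" if "i < n" for i
    unfolding P_def using that wsc by (subst col_mat_of_cols) (auto simp: us_def)
  have pos: "0 < ws ! i \<bullet> ws ! i" if "i < n" for i
    using orth[OF that that] by (auto simp: scalar_prod_def less_le intro: sum_nonneg)
  have "col P i \<bullet> col P j = (if i = j then 1 else 0)" if "i < n" "j < n" for i j
  proof -
    have "col P i \<bullet> col P j = c i * (c j * (ws ! i \<bullet> ws ! j))"
      using wsc[OF that(1)] wsc[OF that(2)] that by (simp add: colP)
    then show ?thesis
      using orth[OF that] pos[OF that(1)] by (auto simp: c_def field_simps)
  qed
  then have "transpose_mat P * P = 1\<^sub>m n"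
    using P by (intro eq_matI) auto
  then show thesis using that P colP[of 0] n hd by simp
qed

text \<open>Deflation: in an orthonormal basis starting with an eigenvector for \<open>e\<close>, a
  symmetric matrix becomes block diagonal with blocks \<open>e\<close> and a smaller symmetric
  matrix, to which induction applies. Taking the roots as a list lets the caller choose the order of
  the diagonal.\<close>

lemma symmetric_orthogonal_diagonalization:
  fixes A :: "real mat"
  assumes "A \<in> carrier_mat n n" "transpose_mat A = A"
    and "char_poly A = (\<Prod>e\<leftarrow>es. [:-e, 1:])"
  shows "\<exists>P \<in> carrier_mat n n. transpose_mat P * P = 1\<^sub>m n \<and>
           transpose_mat P * A * P = mat_diag n (\<lambda>i. es ! i)"
  using assms
proof (induction es arbitrary: n A)
  case Nil
  \<comment> \<open>The degree of the characteristic polynomial is \<open>n\<close>, and an empty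
    product has degree 0.\<close>
  then have "n = 0" using degree_monic_char_poly[of A n] by simp
  then show ?case
    using Nil.prems(1) by (intro bexI[of _ "1\<^sub>m 0"]) (auto simp: mat_diag_def)
next
  case (Cons e es)
  note A = Cons.prems(1) and sym = Cons.prems(2)
  have "eigenvalue A e"
    unfolding eigenvalue_root_char_poly[OF A] Cons.prems(3) by simp
  then obtain v where "eigenvector A v e" unfolding eigenvalue_def by blast
  then have v: "v \<in> carrier_vec n" "v \<noteq> 0\<^sub>v n" and Av: "A *\<^sub>v v = e \<cdot>\<^sub>v v"
    using A unfolding eigenvector_def by auto
  then obtain m where n: "n = Suc m" by (cases n) auto
  obtain P c where P: "P \<in> carrier_mat n n" and PP: "transpose_mat P * P = 1\<^sub>m n"
    and P0: "col P 0 = c \<cdot>\<^sub>v v"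
    using orthonormal_completion[OF v] .
  have P': "transpose_mat P \<in> carrier_mat n n" using P by simp
  have colP: "col P 0 \<in> carrier_vec n" using P v by (simp add: P0)
  have PP': "P * transpose_mat P = 1\<^sub>m n"
    by (rule mat_mult_left_right_inverse[OF P' P PP])
  define B where "B = transpose_mat P * A * P"
  have B: "B \<in> carrier_mat n n" using P A by (simp add: B_def)
  have symB: "transpose_mat B = B"
    using P A by (simp add: B_def sym transpose_mult[of _ n n _ n] assoc_mult_mat[of _ n n _ n _ n])
  \<comment> \<open>The first column of \<open>P\<close> is still an eigenvector for
    \<open>e\<close>, and \<open>transpose_mat P\<close> sends it to the first unit vector. Symmetry
    of \<open>B\<close> then clears the first row as well.\<close>
  have "col B 0 = transpose_mat P *\<^sub>v (A *\<^sub>v col P 0)"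
    using col_mult2[OF P' mult_carrier_mat[OF A P], of 0] col_mult2[OF A P, of 0] n
    by (simp add: B_def assoc_mult_mat[OF P' A P])
  also have "A *\<^sub>v col P 0 = e \<cdot>\<^sub>v col P 0"
    using A v by (simp add: P0 Av mult_mat_vec smult_smult_assoc mult.commute)
  also have "transpose_mat P *\<^sub>v (e \<cdot>\<^sub>v col P 0) = e \<cdot>\<^sub>v col (transpose_mat P * P) 0"
    using mult_mat_vec[OF P' colP, of e] col_mult2[OF P' P] n by simp
  finally have B0: "col B 0 = e \<cdot>\<^sub>v unit_vec n 0"
    using n by (simp add: PP)
  have Bi0: "B $$ (i, 0) = (if i = 0 then e else 0)" if "i < n" for i
    using arg_cong[OF B0, of "\<lambda>w. w $ i"] that B n by auto
  have B0i: "B $$ (0, i) = (if i = 0 then e else 0)" if "i < n" for i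
    using Bi0[OF that] that B n arg_cong[OF symB, of "\<lambda>M. M $$ (0, i)"] by simp
  define E where "E = mat 1 1 (\<lambda>_. e)"
  define D where "D = mat m m (\<lambda>(i, j). B $$ (Suc i, Suc j))"
  have E: "E \<in> carrier_mat 1 1" and D: "D \<in> carrier_mat m m" by (simp_all add: E_def D_def)
  have blk: "B = four_block_mat E (0\<^sub>m 1 m) (0\<^sub>m m 1) D"
    using B n by (intro eq_matI) (auto simp: E_def D_def Bi0 B0i)
  have symD: "transpose_mat D = D"
  proof (intro eq_matI)
    fix i j assume "i < dim_row D" "j < dim_col D"
    then show "transpose_mat D $$ (i, j) = D $$ (i, j)"
      using arg_cong[OF symB, of "\<lambda>M. M $$ (Suc i, Suc j)"] B n by (simp add: D_def)
  qed (simp_all add: D_def)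
  \<comment> \<open>The transpose of \<open>P\<close> is its inverse, so \<open>B\<close> is similar
    to \<open>A\<close>. Cancelling the factor of the block \<open>E\<close> leaves exactly the
    factorization of \<open>char_poly D\<close> that the induction hypothesis asks for.\<close>
  have "similar_mat_wit B A (transpose_mat P) P"
    by (rule similar_mat_witI[of _ _ n]) (use P A B PP PP' in \<open>auto simp: B_def\<close>)
  then have "char_poly B = char_poly A"
    by (intro char_poly_similar) (auto simp: similar_mat_def)
  moreover have "char_poly B = char_poly E * char_poly D"
    unfolding blk by (rule char_poly_four_block_zeros_col[OF E _ D]) simp
  moreover have "char_poly E = [:-e, 1:]"
    by (simp add: E_def char_poly_defs det_def sign_def)
  ultimately have "[:-e, 1:] * char_poly D = [:-e, 1:] * (\<Prod>e\<leftarrow>es. [:-e, 1:])"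
    using Cons.prems(3) by simp
  then have "char_poly D = (\<Prod>e\<leftarrow>es. [:-e, 1:])"
    by (metis mult_cancel_left pCons_eq_0_iff zero_neq_one)
  then obtain R where R: "R \<in> carrier_mat m m" and RR: "transpose_mat R * R = 1\<^sub>m m"
    and RD: "transpose_mat R * D * R = mat_diag m (\<lambda>i. es ! i)"
    using Cons.IH[OF D symD] by blast
  \<comment> \<open>\<open>S\<close> fixes the first basis vector and acts as \<open>R\<close> on
    the rest; the required orthogonal matrix is \<open>P * S\<close>.\<close>
  define S where "S = four_block_mat (1\<^sub>m 1) (0\<^sub>m 1 m) (0\<^sub>m m 1) R"
  have S: "S \<in> carrier_mat n n" using R n by (auto simp: S_def)
  have S': "transpose_mat S = four_block_mat (1\<^sub>m 1) (0\<^sub>m 1 m) (0\<^sub>m m 1) (transpose_mat R)"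
    unfolding S_def by (subst transpose_four_block_mat[of _ 1 1 _ m _ m]) (use R in auto)
  have SS: "transpose_mat S * S = 1\<^sub>m n"
    unfolding S' unfolding S_def
    by (subst mult_four_block_mat[of _ 1 1 _ m _ m _ _ 1 _ m])
      (use R n in \<open>auto simp: RR\<close>)
  have "transpose_mat S * B = four_block_mat E (0\<^sub>m 1 m) (0\<^sub>m m 1) (transpose_mat R * D)"
    unfolding S' blk
    by (subst mult_four_block_mat[of _ 1 1 _ m _ m _ _ 1 _ m]) (use R E D in auto)
  then have "transpose_mat S * B * S
      = four_block_mat E (0\<^sub>m 1 m) (0\<^sub>m m 1) (mat_diag m (\<lambda>i. es ! i))"
    unfolding S_def
    by (simp, subst mult_four_block_mat[of _ 1 1 _ m _ m _ _ 1 _ m]) (use R E D in \<open>auto simp: RD\<close>)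
  also have "\<dots> = mat_diag n (\<lambda>i. (e # es) ! i)"
    using n by (intro eq_matI) (auto simp: mat_diag_def E_def nth_Cons')
  finally have SBS: "transpose_mat S * B * S = mat_diag n (\<lambda>i. (e # es) ! i)" .
  show ?case
  proof (intro bexI[of _ "P * S"] conjI)
    have T: "transpose_mat (P * S) = transpose_mat S * transpose_mat P"
      using P S by (rule transpose_mult)
    have "transpose_mat (P * S) * (P * S) = transpose_mat S * (transpose_mat P * P) * S"
      unfolding T using P S P' by (simp add: assoc_mult_mat[of _ n n _ n _ n])
    then show "transpose_mat (P * S) * (P * S) = 1\<^sub>m n"
      using S by (simp add: PP SS)
    have "transpose_mat (P * S) * A * (P * S) = transpose_mat S * B * S"
      unfolding T B_def using P S P' A by (simp add: assoc_mult_mat[of _ n n _ n _ n])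
    then show "transpose_mat (P * S) * A * (P * S) = mat_diag n (\<lambda>i. (e # es) ! i)"
      using SBS by simp
    show "P * S \<in> carrier_mat n n" using P S by simp
  qed
qed

section \<open>The sorted list of eigenvalues\<close>

lemma eigenvalues_desc_diagonalization:
  fixes A :: "real mat"
  assumes A: "A \<in> carrier_mat n n" and sym: "transpose_mat A = A"
  obtains P where "P \<in> carrier_mat n n" "transpose_mat P * P = 1\<^sub>m n"
    "transpose_mat P * A * P = mat_diag n (\<lambda>i. eigenvalues_desc A ! i)"
proof -
  have ms: "mset (eigenvalues_desc A) = proots (char_poly A)"
    by (simp add: eigenvalues_desc_def)
  have "char_poly A = (\<Prod>e\<leftarrow>eigenvalues_desc A. [:-e, 1:])"
    using symmetric_char_poly_proots(1)[OF A sym]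
    by (simp flip: ms prod_mset_prod_list)
  then show thesis
    using symmetric_orthogonal_diagonalization[OF A sym] that by blast
qed

lemma length_eigenvalues_desc:
  assumes "A \<in> carrier_mat n n" "transpose_mat A = A"
  shows "length (eigenvalues_desc A) = n"
  using symmetric_char_poly_proots(2)[OF assms]
  by (metis eigenvalues_desc_def length_rev mset_sorted_list_of_multiset size_mset)

lemma eigenvalues_desc_antimono:
  assumes "i \<le> j" "j < length (eigenvalues_desc A)"
  shows "eigenvalues_desc A ! j \<le> eigenvalues_desc A ! i"
  using assms unfolding eigenvalues_desc_def
  by (intro sorted_rev_nth_mono) auto

section \<open>Quadratic forms in eigenbases and comparison of eigenvalues\<close>

lemma orthogonal_scalar_prod:
  fixes P :: "real mat"
  assumes "P \<in> carrier_mat n n" "transpose_mat P * P = 1\<^sub>m n" "y \<in> carrier_vec n"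
  shows "(P *\<^sub>v y) \<bullet> (P *\<^sub>v y) = y \<bullet> y"
proof -
  have "(P *\<^sub>v y) \<bullet> (P *\<^sub>v y) = (transpose_mat P *\<^sub>v (P *\<^sub>v y)) \<bullet> y"
    using transpose_vec_mult_scalar[of P n n y "P *\<^sub>v y"] assms by simp
  also have "transpose_mat P *\<^sub>v (P *\<^sub>v y) = y"
    using assms by (simp flip: assoc_mult_mat_vec[of _ n n _ n])
  finally show ?thesis .
qed

lemma diagonalized_quadratic_form:
  fixes P A :: "real mat"
  assumes P: "P \<in> carrier_mat n n" and A: "A \<in> carrier_mat n n" and y: "y \<in> carrier_vec n"
    and D: "transpose_mat P * A * P = mat_diag n f"
  shows "(P *\<^sub>v y) \<bullet> (A *\<^sub>v (P *\<^sub>v y)) = (\<Sum>i<n. f i * (y $ i)\<^sup>2)"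
proof -
  have "(P *\<^sub>v y) \<bullet> (A *\<^sub>v (P *\<^sub>v y)) = y \<bullet> (transpose_mat P *\<^sub>v (A *\<^sub>v (P *\<^sub>v y)))"
    using transpose_vec_mult_scalar[of P n n y "A *\<^sub>v (P *\<^sub>v y)"] P A y
    by (simp add: comm_scalar_prod[of _ n])
  also have "transpose_mat P *\<^sub>v (A *\<^sub>v (P *\<^sub>v y)) = mat_diag n f *\<^sub>v y"
    using P A y by (simp add: assoc_mult_mat_vec[of _ n n _ n] flip: D)
  also have "mat_diag n f *\<^sub>v y = vec n (\<lambda>i. f i * y $ i)"
    using y by (intro eq_vecI)
      (auto simp: mat_diag_def scalar_prod_def if_distrib[of "\<lambda>x. x * _"] cong: if_cong)
  also have "y \<bullet> vec n (\<lambda>i. f i * y $ i) = (\<Sum>i<n. f i * (y $ i)\<^sup>2)"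
    using y by (simp add: scalar_prod_def atLeast0LessThan power2_eq_square mult_ac)
  finally show ?thesis .
qed

text \<open>
  The plane spanned by the two top eigenvectors of \<open>A\<close> contains a nonzero vector orthogonal to
  the top eigenvector of \<open>B\<close>; compare the two quadratic forms at this vector.
\<close>

lemma second_eigenvalue_mono:
  fixes A B :: "real mat"
  assumes A: "A \<in> carrier_mat n n" "transpose_mat A = A"
    and B: "B \<in> carrier_mat n n" "transpose_mat B = B"
    and n: "2 \<le> n"
    and le: "\<And>x. x \<in> carrier_vec n \<Longrightarrow> x \<bullet> (A *\<^sub>v x) \<le> x \<bullet> (B *\<^sub>v x)"
  shows "eigenvalues_desc A ! 1 \<le> eigenvalues_desc B ! 1"
proof -
  obtain P where P: "P \<in> carrier_mat n n" "transpose_mat P * P = 1\<^sub>m n"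
    and PA: "transpose_mat P * A * P = mat_diag n (\<lambda>i. eigenvalues_desc A ! i)"
    using eigenvalues_desc_diagonalization[OF A] .
  obtain Q where Q: "Q \<in> carrier_mat n n" "transpose_mat Q * Q = 1\<^sub>m n"
    and QB: "transpose_mat Q * B * Q = mat_diag n (\<lambda>i. eigenvalues_desc B ! i)"
    using eigenvalues_desc_diagonalization[OF B] .
  have QQ': "Q * transpose_mat Q = 1\<^sub>m n"
    using mat_mult_left_right_inverse[OF _ Q(1,2)] Q(1) by simp
  define M where "M = transpose_mat Q * P"
  have M: "M \<in> carrier_mat n n" using P Q by (simp add: M_def)
  \<comment> \<open>One homogeneous linear equation in two unknowns has a nontrivial solution. Its
    left side will be the component of the test vector along the top eigenvector of
    \<open>B\<close>.\<close>
  obtain a b :: real where ab: "a * M $$ (0, 0) + b * M $$ (0, 1) = 0" "a \<noteq> 0 \<or> b \<noteq> 0"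
  proof (cases "M $$ (0, 0) = 0 \<and> M $$ (0, 1) = 0")
    case True
    then show thesis using that[of 1 0] by simp
  next
    case False
    then show thesis using that[of "M $$ (0, 1)" "- M $$ (0, 0)"] by auto
  qed
  have split2: "(\<Sum>i<n. g i) = g 0 + g 1 + (\<Sum>i\<in>{2..<n}. g i)" for g :: "nat \<Rightarrow> real"
    using n by (simp add: lessThan_atLeast0 sum.atLeast_Suc_lessThan numeral_2_eq_2)
  \<comment> \<open>\<open>x\<close> is the test vector; \<open>y\<close> and \<open>z\<close> are
    its coordinates in the eigenbases of \<open>A\<close> and \<open>B\<close>. By construction
    \<open>y\<close> is supported on the first two positions.\<close>
  define y where "y = vec n (\<lambda>i. if i = 0 then a else if i = 1 then b else 0)"
  define x where "x = P *\<^sub>v y"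
  define z where "z = transpose_mat Q *\<^sub>v x"
  have y: "y \<in> carrier_vec n" and x: "x \<in> carrier_vec n" and z: "z \<in> carrier_vec n"
    using P Q by (auto simp: y_def x_def z_def)
  have Qz: "Q *\<^sub>v z = x"
    using Q x by (simp add: z_def QQ' flip: assoc_mult_mat_vec[of _ n n _ n])
  have "z = M *\<^sub>v y"
    using P Q y by (simp add: z_def x_def M_def)
  then have "z $ 0 = (\<Sum>i<n. M $$ (0, i) * y $ i)"
    using M n y by (simp add: scalar_prod_def atLeast0LessThan)
  then have z0: "z $ 0 = 0"
    using ab(1) n unfolding split2 by (simp add: y_def mult.commute)
  have yy: "y \<bullet> y = (\<Sum>i<n. (y $ i)\<^sup>2)" and zz: "z \<bullet> z = (\<Sum>i<n. (z $ i)\<^sup>2)"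
    using y z by (simp_all add: scalar_prod_def atLeast0LessThan power2_eq_square)
  \<comment> \<open>Both coordinate vectors have the length of \<open>x\<close>, so the bounds on
    the two sides carry the same factor, which is cancelled at the end.\<close>
  have norm: "y \<bullet> y = z \<bullet> z"
    using orthogonal_scalar_prod[OF P y] orthogonal_scalar_prod[OF Q z] Qz by (simp add: x_def)
  have "y $ 0 \<noteq> 0 \<or> y $ 1 \<noteq> 0" using ab(2) n by (simp add: y_def)
  then have "y \<noteq> 0\<^sub>v n" using n by auto
  then have pos: "0 < y \<bullet> y" using real_scalar_prod_self_pos[OF y] by simp
  \<comment> \<open>Index 1 is the second largest eigenvalue. For \<open>A\<close> only positions 0
    and 1 contribute, and their eigenvalues are at least that one; for \<open>B\<close> position 0
    vanishes by \<open>z0\<close>, and the remaining eigenvalues are at most the second.\<close>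
  have "eigenvalues_desc A ! 1 * (y \<bullet> y) = (\<Sum>i<n. eigenvalues_desc A ! 1 * (y $ i)\<^sup>2)"
    by (simp add: yy sum_distrib_left)
  also have "\<dots> \<le> (\<Sum>i<n. eigenvalues_desc A ! i * (y $ i)\<^sup>2)"
  proof (intro sum_mono)
    fix i assume i: "i \<in> {..<n}"
    show "eigenvalues_desc A ! 1 * (y $ i)\<^sup>2 \<le> eigenvalues_desc A ! i * (y $ i)\<^sup>2"
    proof (cases "i \<le> 1")
      case True
      then show ?thesis
        using n length_eigenvalues_desc[OF A]
        by (intro mult_right_mono eigenvalues_desc_antimono) auto
    next
      case False
      then show ?thesis using i by (simp add: y_def)
    qed
  qed
  also have "\<dots> = x \<bullet> (A *\<^sub>v x)"
    unfolding x_def using diagonalized_quadratic_form[OF P(1) A(1) y PA] by simp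
  also have "\<dots> \<le> x \<bullet> (B *\<^sub>v x)"
    by (rule le[OF x])
  also have "\<dots> = (\<Sum>i<n. eigenvalues_desc B ! i * (z $ i)\<^sup>2)"
    using diagonalized_quadratic_form[OF Q(1) B(1) z QB] by (simp add: Qz)
  also have "\<dots> \<le> (\<Sum>i<n. eigenvalues_desc B ! 1 * (z $ i)\<^sup>2)"
  proof (intro sum_mono)
    fix i assume i: "i \<in> {..<n}"
    show "eigenvalues_desc B ! i * (z $ i)\<^sup>2 \<le> eigenvalues_desc B ! 1 * (z $ i)\<^sup>2"
    proof (cases "i = 0")
      case False
      then show ?thesis
        using i length_eigenvalues_desc[OF B]
        by (intro mult_right_mono eigenvalues_desc_antimono) auto
    qed (simp add: z0)
  qed
  also have "\<dots> = eigenvalues_desc B ! 1 * (y \<bullet> y)"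
    by (simp add: norm zz sum_distrib_left)
  finally show ?thesis using pos by simp
qed

text \<open>Evaluated at column \<open>i\<close> of the diagonalizing matrix, the quadratic form is
  exactly the eigenvalue at position \<open>i\<close>.\<close>

lemma positive_semidefinite_eigenvalue_nonneg:
  assumes A: "A \<in> carrier_mat n n" and psd: "positive_semidefinite A" and i: "i < n"
  shows "0 \<le> eigenvalues_desc A ! i"
proof -
  have sym: "transpose_mat A = A" using psd by (simp add: positive_semidefinite_def)
  obtain P where P: "P \<in> carrier_mat n n"
    and PA: "transpose_mat P * A * P = mat_diag n (\<lambda>i. eigenvalues_desc A ! i)"
    using eigenvalues_desc_diagonalization[OF A sym] .
  let ?x = "P *\<^sub>v unit_vec n i"
  have "0 \<le> ?x \<bullet> (A *\<^sub>v ?x)"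
    using psd A P by (auto simp: positive_semidefinite_def)
  also have "\<dots> = (\<Sum>j<n. eigenvalues_desc A ! j * (unit_vec n i $ j)\<^sup>2)"
    by (rule diagonalized_quadratic_form[OF P A _ PA]) simp
  also have "\<dots> = (\<Sum>j<n. if j = i then eigenvalues_desc A ! j else 0)"
    by (intro sum.cong) (use i in \<open>auto simp: unit_vec_def\<close>)
  finally show ?thesis using i by simp
qed

section \<open>The rank-one update and the final estimate\<close>

lemma outer_product_eq_mat:
  "outer_product u v = mat (dim_vec u) (dim_vec v) (\<lambda>(i, j). u $ i * v $ j)"
  unfolding outer_product_def
  by (intro eq_matI) (auto simp: scalar_prod_def mat_of_cols_def mat_of_rows_def)

lemma smult_outer_product_mult_vec:
  assumes "v \<in> carrier_vec n" "x \<in> carrier_vec n"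
  shows "(k \<cdot>\<^sub>m outer_product u v) *\<^sub>v x = (k * (v \<bullet> x)) \<cdot>\<^sub>v u"
  unfolding outer_product_eq_mat using assms
  by (intro eq_vecI) (auto simp: scalar_prod_def sum_distrib_left mult_ac)

theorem proposition7:
  fixes n :: nat and W :: "real mat"
  assumes "n \<ge> 2"
    and "row_stochastic n W"
    and "strongly_connected (communication_graph W)"
    and "transpose_mat W = W"
    and "positive_semidefinite W"
  shows "\<forall>i<n. \<forall>j<n. lambda_max W \<le> lambda_max (remove_edge W i j)"
proof (intro allI impI)
  fix i j assume i: "i < n" and j: "j < n"
  have W: "W \<in> carrier_mat n n" and w: "0 \<le> W $$ (i, j)"
    using assms(2) i j by (auto simp: row_stochastic_def)
  \<comment> \<open>For \<open>i = j\<close> this is the zero vector and the matrix is unchanged, so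
    the argument covers that case too.\<close>
  define d :: "real vec" where "d = unit_vec n i - unit_vec n j"
  have d: "d \<in> carrier_vec n" by (simp add: d_def)
  have V_eq: "remove_edge W i j = W + W $$ (i, j) \<cdot>\<^sub>m outer_product d d"
    using W by (simp add: remove_edge_def d_def Let_def)
  let ?V = "remove_edge W i j"
  have O: "outer_product d d \<in> carrier_mat n n"
    using d by (simp add: outer_product_eq_mat)
  have V: "?V \<in> carrier_mat n n" using W O by (simp add: V_eq)
  have "W $$ (l, k) = W $$ (k, l)" if "k < n" "l < n" for k l
    using arg_cong[OF assms(4), of "\<lambda>A. A $$ (k, l)"] W that by simp
  then have symV: "transpose_mat ?V = ?V"
    using W d by (intro eq_matI) (auto simp: V_eq outer_product_eq_mat mult.commute)
  have "x \<bullet> (W *\<^sub>v x) \<le> x \<bullet> (?V *\<^sub>v x)" if x: "x \<in> carrier_vec n" for x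
  proof -
    have "?V *\<^sub>v x = W *\<^sub>v x + (W $$ (i, j) * (d \<bullet> x)) \<cdot>\<^sub>v d"
      using W O x d
      by (simp add: V_eq add_mult_distrib_mat_vec[of _ n n]
          smult_outer_product_mult_vec[of _ n])
    \<comment> \<open>The update adds a square weighted by the nonnegative entry of
      \<open>W\<close>, hence the form can only grow.\<close>
    then have "x \<bullet> (?V *\<^sub>v x) = x \<bullet> (W *\<^sub>v x) + W $$ (i, j) * (d \<bullet> x)\<^sup>2"
      using W x d
      by (simp add: scalar_prod_add_distrib[of _ n] comm_scalar_prod[of x n d] power2_eq_square)
    then show ?thesis using w by simp
  qed
  then have mono: "eigenvalues_desc W ! 1 \<le> eigenvalues_desc ?V ! 1"
    using second_eigenvalue_mono[OF W assms(4) V symV assms(1)] by blast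
  \<comment> \<open>The list is indexed from 0, so position \<open>n - 1\<close> holds the smallest
    eigenvalue. As it is nonnegative and below the second, both absolute values drop and the maximum
    is the second eigenvalue.\<close>
  have "0 \<le> eigenvalues_desc W ! (n - 1)"
    using positive_semidefinite_eigenvalue_nonneg[OF W assms(5)] assms(1) by simp
  moreover have "eigenvalues_desc W ! (n - 1) \<le> eigenvalues_desc W ! 1"
    using assms(1) length_eigenvalues_desc[OF W assms(4)]
    by (intro eigenvalues_desc_antimono) auto
  ultimately have "lambda_max W = eigenvalues_desc W ! 1"
    using W by (simp add: lambda_max_def kth_eigenvalue_def)
  \<comment> \<open>For the updated matrix the definition alone suffices: \<open>lambda_max\<close>
    dominates the absolute value of the second eigenvalue, hence that eigenvalue itself.\<close>
  also have "\<dots> \<le> lambda_max ?V"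
    using mono by (simp add: lambda_max_def kth_eigenvalue_def)
  finally show "lambda_max W \<le> lambda_max ?V" .
qed

end
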